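(* Let $L>3d_k$. Then there exists a constant $C>0$ such that for all $x,y_1,y_2\in\mathbb R^d$ and all $j\in\mathbb Z$, $$\int_{\mathbb R^d}\frac{d\mu_k(u)}{\big[(1+2^jd_G(x,u))(1+2^jd_G(y_1,u))(1+2^jd_G(y_2,u))\big]^{3L}}\le\frac{C\,\mu_k(B(x,2^{-j}))}{\big[(1+2^jd_G(x,y_1))(1+2^jd_G(x,y_2))\big]^{L}};$$ that is, the constant $C$ is independent of $x,y_1,y_2$ and $j$.
   Context: For $0\ne\lambda\in\mathbb R^d$ let $\sigma_\lambda(x)=x-2\frac{\langle x,\lambda\rangle}{|\lambda|^2}\lambda$. A root system is a finite set $R\subset\mathbb R^d\setminus\{0\}$ with $R\cap\mathbb R\lambda=\{\pm\lambda\}$ and $\sigma_\lambda(R)=R$ for all $\lambda\in R$. Fix a root system $R$ normalized by $|\lambda|=\sqrt2$ for all $\lambda\in R$, let $G$ be the finite group generated by $\{\sigma_\lambda:\lambda\in R\}$, and fix a $G$-invariant function $k:R\to[0,\infty)$. Put $d_k=d+\sum_{\lambda\in R}k(\lambda)$ and $d_G(x,y)=\min_{\sigma\in G}|\sigma(x)-y|$. The measure is $d\mu_k(x)=c_k\prod_{\lambda\in R}|\langle x,\lambda\rangle|^{k(\lambda)}\,dx$ with $c_k^{-1}=\int_{\mathbb R^d}e^{-|x|^2/2}\prod_{\lambda\in R}|\langle x,\lambda\rangle|^{k(\lambda)}\,dx$. $B(x,r)$ is the Euclidean ball of centre $x$ and radius $r$. *)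

theory Defs
  imports "HOL-Analysis.Analysis" "HOL-Algebra.Bij" "HOL-Algebra.Generated_Groups"
begin

definition root_reflection :: "real ^ 'd \<Rightarrow> real ^ 'd \<Rightarrow> real ^ 'd" where
  "root_reflection l x = x - (2 * (x \<bullet> l) / (norm l)\<^sup>2) *\<^sub>R l"

definition root_system :: "(real ^ 'd) set \<Rightarrow> bool" where
  "root_system R \<longleftrightarrow> finite R \<and> 0 \<notin> R \<and>
     (\<forall>l\<in>R. R \<inter> range (\<lambda>c. c *\<^sub>R l) = {l, - l} \<and> root_reflection l ` R = R)"

text \<open>\<open>Min\<close> in \<open>orbit_dist\<close> below is meaningful because this group is finite for a root system:
  its elements are linear, permute \<open>R\<close> and fix the orthogonal complement of \<open>R\<close>.\<close>

definition reflection_group :: "(real ^ 'd) set \<Rightarrow> (real ^ 'd \<Rightarrow> real ^ 'd) set" where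
  "reflection_group R = generate (BijGroup UNIV) (root_reflection ` R)"

definition orbit_dist :: "(real ^ 'd) set \<Rightarrow> real ^ 'd \<Rightarrow> real ^ 'd \<Rightarrow> real" where
  "orbit_dist R x y = Min ((\<lambda>g. norm (g x - y)) ` reflection_group R)"

definition hom_dim :: "(real ^ 'd) set \<Rightarrow> (real ^ 'd \<Rightarrow> real) \<Rightarrow> real" where
  "hom_dim R k = real CARD('d) + (\<Sum>l\<in>R. k l)"

text \<open>The case distinction enforces \<open>t\<^sup>0 = 1\<close> also at \<open>t = 0\<close>, where \<open>0 powr 0 = 0\<close>.\<close>

definition dunkl_weight :: "(real ^ 'd) set \<Rightarrow> (real ^ 'd \<Rightarrow> real) \<Rightarrow> real ^ 'd \<Rightarrow> real" where
  "dunkl_weight R k x = (\<Prod>l\<in>R. if k l = 0 then 1 else \<bar>x \<bullet> l\<bar> powr k l)"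

definition dunkl_const :: "(real ^ 'd) set \<Rightarrow> (real ^ 'd \<Rightarrow> real) \<Rightarrow> real" where
  "dunkl_const R k = inverse (LINT x|lborel. exp (- (norm x)\<^sup>2 / 2) * dunkl_weight R k x)"

definition dunkl_measure :: "(real ^ 'd) set \<Rightarrow> (real ^ 'd \<Rightarrow> real) \<Rightarrow> (real ^ 'd) measure" where
  "dunkl_measure R k = density lborel (\<lambda>x. ennreal (dunkl_const R k * dunkl_weight R k x))"

end

theory Submission
  imports Defs
begin

text \<open>
  Write \<open>r = 2\<^sup>-\<^sup>j\<close> and \<open>D\<close> for the orbit distance. The triangle inequality for \<open>D\<close> gives
  \<open>1 + D x y / r \<le> (1 + D x u / r) (1 + D y u / r)\<close>, which reduces the claim to
  \<open>\<integral> (1 + D x u / r)\<^sup>-\<^sup>L d\<mu>(u) \<le> C \<mu>(B(x, r))\<close>. Both sides are comparable to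
  \<open>r\<^sup>d \<Prod>\<^sub>l (\<bar>\<langle>x, l\<rangle>\<bar> + 2 r)\<^sup>k\<^sup>(\<^sup>l\<^sup>)\<close>, a quantity that is invariant under the reflection group:
  the weight at \<open>u\<close> is at most this product times a power of \<open>1 + \<bar>u - x\<bar> / r\<close>, which the decay
  absorbs; conversely every ball contains a ball of comparable radius that stays away from all root
  hyperplanes, and there the weight is at least a constant times the product. The normalizing
  constant \<open>c\<^sub>k\<close> enters both sides linearly, so only \<open>c\<^sub>k \<ge> 0\<close> matters.
\<close>

section \<open>The reflection group and the orbit distance\<close>

lemma root_reflection_involutive:
  assumes "l \<noteq> 0"
  shows "root_reflection l (root_reflection l x) = x"
proof -
  have "l \<bullet> l \<noteq> 0" using assms by simp
  then show ?thesis
    by (simp add: root_reflection_def power2_norm_eq_inner algebra_simps)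
qed

lemma orthogonal_transformation_root_reflection:
  assumes "l \<noteq> 0"
  shows "orthogonal_transformation (root_reflection l)"
proof -
  have l: "l \<bullet> l \<noteq> 0" using assms by simp
  have "linear (root_reflection l)"
    by (rule linearI)
      (simp_all add: root_reflection_def algebra_simps add_divide_distrib)
  moreover have "root_reflection l v \<bullet> root_reflection l w = v \<bullet> w" for v w
    using l by (simp add: root_reflection_def power2_norm_eq_inner algebra_simps inner_commute)
  ultimately show ?thesis
    by (simp add: orthogonal_transformation_def)
qed

section \<open>Operations of the group of bijections as composition, identity and inverse
  map\<close>

lemma carrier_BijGroup_UNIV: "f \<in> carrier (BijGroup UNIV) \<longleftrightarrow> bij f"
  by (simp add: BijGroup_def Bij_def)

lemma mult_BijGroup_UNIV:
  "bij f \<Longrightarrow> bij g \<Longrightarrow> f \<otimes>\<^bsub>BijGroup UNIV\<^esub> g = f \<circ> g"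
  by (simp add: BijGroup_def Bij_def compose_def fun_eq_iff)

lemma one_BijGroup_UNIV: "\<one>\<^bsub>BijGroup UNIV\<^esub> = id"
  by (simp add: BijGroup_def fun_eq_iff)

lemma inv_BijGroup_UNIV:
  assumes "bij f"
  shows "inv\<^bsub>BijGroup UNIV\<^esub> f = inv_into UNIV f"
proof -
  interpret group "BijGroup (UNIV :: 'a set)" by (rule group_BijGroup)
  have "bij (inv_into UNIV f)" using assms by (rule bij_imp_bij_inv)
  then show ?thesis
    using assms by (intro inv_equality)
      (simp_all add: carrier_BijGroup_UNIV mult_BijGroup_UNIV one_BijGroup_UNIV bij_is_inj)
qed

section \<open>Orthogonality, permutation of the roots and finiteness of the reflection
  group\<close>

context
  fixes R :: "(real ^ 'd) set"
  assumes R: "root_system R"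
begin

lemma finite_roots: "finite R" and zero_notin_roots: "0 \<notin> R"
  using R by (auto simp: root_system_def)

lemma root_nonzero: "l \<in> R \<Longrightarrow> l \<noteq> 0"
  using zero_notin_roots by auto

lemma root_reflection_properties:
  assumes "l \<in> R"
  shows "orthogonal_transformation (root_reflection l) \<and> root_reflection l ` R = R \<and>
    (\<forall>x. (\<forall>l\<in>R. x \<bullet> l = 0) \<longrightarrow> root_reflection l x = x)"
proof -
  have "root_reflection l ` R = R" using R assms by (simp add: root_system_def)
  moreover have "root_reflection l x = x" if "\<forall>l\<in>R. x \<bullet> l = 0" for x
    using that assms by (simp add: root_reflection_def)
  ultimately show ?thesis
    using orthogonal_transformation_root_reflection[OF root_nonzero[OF assms]] by blast
qed

text \<open>All three clauses hold for the generators and survive composition, so induction over the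
  generation of the group applies. The clause on vectors orthogonal to \<open>R\<close> is carried
  along for the proof of finiteness.\<close>

lemma reflection_group_properties:
  assumes "g \<in> reflection_group R"
  shows "orthogonal_transformation g \<and> g ` R = R \<and> (\<forall>x. (\<forall>l\<in>R. x \<bullet> l = 0) \<longrightarrow> g x = x)"
  using assms unfolding reflection_group_def
proof (induction rule: generate.induct)
  case one
  then show ?case by (simp add: one_BijGroup_UNIV)
next
  case (incl h)
  then show ?case using root_reflection_properties by blast
next
  case (inv h)
  then obtain l where l: "l \<in> R" "h = root_reflection l" by auto
  have "bij h"
    using l orthogonal_transformation_root_reflection[OF root_nonzero] orthogonal_transformation_bij by blast
  \<comment> \<open>A reflection is an involution, so inverse generators are generators
    again.\<close>
  then have "inv\<^bsub>BijGroup UNIV\<^esub> h = h"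
    using l root_reflection_involutive[OF root_nonzero]
    by (metis inv_BijGroup_UNIV inv_equality)
  then show ?case
    using l root_reflection_properties by auto
next
  case (eng h1 h2)
  then have "h1 \<otimes>\<^bsub>BijGroup UNIV\<^esub> h2 = h1 \<circ> h2"
    by (intro mult_BijGroup_UNIV) (auto intro: orthogonal_transformation_bij)
  then show ?case
    using eng.IH
    by (metis comp_apply image_comp orthogonal_transformation_compose)
qed

lemma reflection_group_orthogonal: "g \<in> reflection_group R \<Longrightarrow> orthogonal_transformation g"
  and reflection_group_image: "g \<in> reflection_group R \<Longrightarrow> g ` R = R"
  using reflection_group_properties by auto

lemma root_reflections_subset_carrier: "root_reflection ` R \<subseteq> carrier (BijGroup UNIV)"
  by (auto simp: carrier_BijGroup_UNIV
      intro!: orthogonal_transformation_bij orthogonal_transformation_root_reflection root_nonzero)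

lemma reflection_group_compose:
  assumes "g \<in> reflection_group R" "h \<in> reflection_group R"
  shows "g \<circ> h \<in> reflection_group R"
proof -
  have "bij g" "bij h"
    using assms by (auto intro: orthogonal_transformation_bij reflection_group_orthogonal)
  then show ?thesis
    using assms generate.eng[of g "BijGroup UNIV" "root_reflection ` R" h]
    by (simp add: reflection_group_def mult_BijGroup_UNIV)
qed

lemma reflection_group_inv:
  assumes "g \<in> reflection_group R"
  shows "inv_into UNIV g \<in> reflection_group R"
proof -
  have "bij g"
    using assms by (auto intro: orthogonal_transformation_bij reflection_group_orthogonal)
  then show ?thesis
    using assms group.generate_m_inv_closed[OF group_BijGroup root_reflections_subset_carrier, of g]
    by (simp add: reflection_group_def inv_BijGroup_UNIV)
qed

lemma reflection_group_nonempty: "reflection_group R \<noteq> {}"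
  using generate.one by (auto simp: reflection_group_def)

text \<open>Restriction to \<open>R\<close> embeds the group into the finite set of self-maps of
  \<open>R\<close>. It is injective because a group element is linear, hence determined on
  \<open>span R\<close> by its values on \<open>R\<close>, and is the identity on the orthogonal
  complement.\<close>

lemma finite_reflection_group: "finite (reflection_group R)"
proof (rule inj_on_finite)
  show "inj_on (\<lambda>g. restrict g R) (reflection_group R)"
  proof (rule inj_onI, rule ext)
    fix g h x
    assume g: "g \<in> reflection_group R" and h: "h \<in> reflection_group R"
      and eq: "restrict g R = restrict h R"
    obtain y z where y: "y \<in> span R" and z: "\<And>w. w \<in> span R \<Longrightarrow> orthogonal z w"
      and x: "x = y + z"
      using orthogonal_subspace_decomp_exists by blast
    have lin: "linear g" "linear h"
      using g h by (auto intro: orthogonal_transformation_linear reflection_group_orthogonal)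
    have "g l = h l" if "l \<in> R" for l
      using fun_cong[OF eq, of l] that by simp
    then have "g y = h y"
      using lin y linear_eq_on by blast
    moreover have "g z = z" "h z = z"
      using reflection_group_properties[OF g] reflection_group_properties[OF h] z
      by (auto simp: orthogonal_def span_base)
    ultimately show "g x = h x"
      using lin by (simp add: x linear_add)
  qed
  show "(\<lambda>g. restrict g R) ` reflection_group R \<subseteq> R \<rightarrow>\<^sub>E R"
    using reflection_group_image by fastforce
  show "finite (R \<rightarrow>\<^sub>E R)"
    using finite_roots by (intro finite_PiE)
qed

section \<open>The orbit distance and its triangle inequality\<close>

lemma orbit_dist_le: "g \<in> reflection_group R \<Longrightarrow> orbit_dist R x y \<le> norm (g x - y)"
  unfolding orbit_dist_def using finite_reflection_group by (intro Min_le) auto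

lemma orbit_dist_attained: obtains g where "g \<in> reflection_group R" "orbit_dist R x y = norm (g x - y)"
proof -
  have "orbit_dist R x y \<in> (\<lambda>g. norm (g x - y)) ` reflection_group R"
    unfolding orbit_dist_def using finite_reflection_group reflection_group_nonempty
    by (intro Min_in) auto
  then show thesis using that by auto
qed

lemma orbit_dist_nonneg: "0 \<le> orbit_dist R x y"
  by (rule orbit_dist_attained[of x y]) simp

text \<open>Take minimizers \<open>g\<close> for \<open>x\<close> and \<open>h\<close> for
  \<open>y\<close>. Since \<open>h\<close> is a linear isometry, the group element
  \<open>inv_into UNIV h \<circ> g\<close> moves \<open>x\<close> to distance
  \<open>norm (g x - h y)\<close> from \<open>y\<close>. Having \<open>u\<close> in the second
  argument throughout matches the integrand of the theorem.\<close>

lemma orbit_dist_triangle: "orbit_dist R x y \<le> orbit_dist R x u + orbit_dist R y u"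
proof -
  obtain g where g: "g \<in> reflection_group R" "orbit_dist R x u = norm (g x - u)"
    by (rule orbit_dist_attained)
  obtain h where h: "h \<in> reflection_group R" "orbit_dist R y u = norm (h y - u)"
    by (rule orbit_dist_attained)
  have oh: "orthogonal_transformation h" using h reflection_group_orthogonal by blast
  define f where "f = inv_into UNIV h \<circ> g"
  have "h (f x - y) = g x - h y"
    using oh orthogonal_transformation_bij[OF oh]
    by (simp add: f_def linear_diff orthogonal_transformation_linear bij_is_surj surj_f_inv_f)
  then have "norm (f x - y) = norm (g x - h y)"
    using orthogonal_transformation_norm[OF oh] by metis
  moreover have "f \<in> reflection_group R"
    unfolding f_def using g h by (intro reflection_group_compose reflection_group_inv)
  ultimately have "orbit_dist R x y \<le> norm (g x - h y)"
    using orbit_dist_le by metis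
  also have "\<dots> \<le> norm (g x - u) + norm (h y - u)"
    using norm_triangle_ineq4[of "g x - u" "h y - u"] by simp
  finally show ?thesis using g h by simp
qed

end

section \<open>Distance from hyperplanes and radial decay\<close>

text \<open>Supplies centres of balls on which the weight is bounded below; the point is that
  \<open>\<epsilon>\<close> is uniform in \<open>x\<close>. In the induction half of the radius goes
  to the old hyperplanes and half to the new one.\<close>

lemma exists_far_from_hyperplanes:
  fixes R :: "'a :: real_inner set"
  assumes "finite R" "0 \<notin> R" "0 < \<rho>"
  shows "\<exists>\<epsilon>>0. \<forall>x. \<exists>z. norm (z - x) \<le> \<rho> \<and> (\<forall>l\<in>R. \<epsilon> \<le> \<bar>z \<bullet> l\<bar>)"
  using assms
proof (induction arbitrary: \<rho> rule: finite_induct)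
  case empty
  have "\<exists>z. norm (z - x) \<le> \<rho>" for x :: 'a
    using \<open>0 < \<rho>\<close> by (intro exI[of _ x]) simp
  then show ?case by (intro exI[of _ 1]) simp
next
  case (insert l R)
  \<comment> \<open>Move a point that is far from the old hyperplanes a little further away from the new one.\<close>
  from insert.prems insert.IH[of "\<rho> / 2"] obtain e where e: "e > 0"
    and e': "\<And>x. \<exists>z. norm (z - x) \<le> \<rho> / 2 \<and> (\<forall>l\<in>R. e \<le> \<bar>z \<bullet> l\<bar>)"
    by auto
  have l: "norm l > 0" using insert.prems by auto
  \<comment> \<open>A common bound for the norms of the old roots; the summand 1 makes it a safe
    divisor.\<close>
  define S where "S = 1 + (\<Sum>l'\<in>R. norm l')"
  have S: "S \<ge> 1" "\<And>l'. l' \<in> R \<Longrightarrow> norm l' \<le> S"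
  proof -
    show "S \<ge> 1" by (simp add: S_def sum_nonneg)
    show "norm l' \<le> S" if "l' \<in> R" for l'
      using member_le_sum[OF that, of norm] insert.hyps by (simp add: S_def)
  qed
  \<comment> \<open>The step length: the first bound respects the remaining radius, the second
    ensures that inner products with old roots change by at most \<open>e / 2\<close>.\<close>
  define t where "t = min (\<rho> / 2) (e / (2 * S))"
  have t: "t > 0" "t \<le> \<rho> / 2" "t * S \<le> e / 2"
  proof -
    show "t > 0" "t \<le> \<rho> / 2" using e S insert.prems by (auto simp: t_def)
    have "t \<le> e / (2 * S)" by (simp add: t_def)
    then show "t * S \<le> e / 2" using S by (simp add: field_simps)
  qed
  define \<epsilon> where "\<epsilon> = min (e / 2) (t * norm l)"
  show ?case
  proof (intro exI[of _ \<epsilon>] conjI allI)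
    show "\<epsilon> > 0" using e t l by (simp add: \<epsilon>_def)
    fix x
    obtain y where y: "norm (y - x) \<le> \<rho> / 2" "\<And>l'. l' \<in> R \<Longrightarrow> e \<le> \<bar>y \<bullet> l'\<bar>"
      using e'[of x] by blast
    \<comment> \<open>The sign is chosen so that the move increases the absolute value of the inner
      product with \<open>l\<close>, by exactly \<open>t * norm l\<close>.\<close>
    define s :: real where "s = (if y \<bullet> l \<ge> 0 then t else - t)"
    define z where "z = y + (s / norm l) *\<^sub>R l"
    have zy: "norm (z - y) \<le> t" using t l by (simp add: z_def s_def)
    have zl: "z \<bullet> l = y \<bullet> l + s * norm l"
      using l by (simp add: z_def inner_add_left dot_square_norm power2_eq_square)
    have "t * norm l \<le> \<bar>z \<bullet> l\<bar>"
    proof -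
      have "0 < t * norm l" using t l by simp
      then show ?thesis unfolding zl s_def by simp
    qed
    moreover have "e / 2 \<le> \<bar>z \<bullet> l'\<bar>" if "l' \<in> R" for l'
    proof -
      have "\<bar>(z - y) \<bullet> l'\<bar> \<le> norm (z - y) * norm l'" by (rule Cauchy_Schwarz_ineq2)
      also have "\<dots> \<le> t * S" using zy S that t by (intro mult_mono) auto
      finally show ?thesis using t y(2)[OF that] by (simp add: inner_diff_left)
    qed
    moreover have "norm (z - x) \<le> \<rho>"
      using norm_triangle_ineq[of "z - y" "y - x"] zy y t by simp
    ultimately have "norm (z - x) \<le> \<rho> \<and> (\<forall>l'\<in>insert l R. \<epsilon> \<le> \<bar>z \<bullet> l'\<bar>)"
      unfolding \<epsilon>_def by (simp add: min.coboundedI1 min.coboundedI2)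
    then show "\<exists>z. norm (z - x) \<le> \<rho> \<and> (\<forall>l'\<in>insert l R. \<epsilon> \<le> \<bar>z \<bullet> l'\<bar>)" ..
  qed
qed

text \<open>The hyperplanes pass through the origin and are preserved by dilations, so a point found
  near \<open>x /\<^sub>R r\<close> is multiplied by \<open>r\<close>.\<close>

lemma exists_far_from_hyperplanes_scaled:
  fixes R :: "'a :: real_inner set"
  assumes "finite R" "0 \<notin> R" "0 < \<rho>"
  shows "\<exists>\<epsilon>>0. \<forall>x. \<forall>r>0. \<exists>z. norm (z - x) \<le> \<rho> * r \<and> (\<forall>l\<in>R. \<epsilon> * r \<le> \<bar>z \<bullet> l\<bar>)"
proof -
  obtain \<epsilon> where \<epsilon>: "\<epsilon> > 0"
    and z: "\<And>x. \<exists>z. norm (z - x) \<le> \<rho> \<and> (\<forall>l\<in>R. \<epsilon> \<le> \<bar>z \<bullet> l\<bar>)"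
    using exists_far_from_hyperplanes[OF assms] by blast
  have "\<exists>z. norm (z - x) \<le> \<rho> * r \<and> (\<forall>l\<in>R. \<epsilon> * r \<le> \<bar>z \<bullet> l\<bar>)" if "r > 0" for x r
  proof -
    obtain z where z: "norm (z - x /\<^sub>R r) \<le> \<rho>" "\<And>l. l \<in> R \<Longrightarrow> \<epsilon> \<le> \<bar>z \<bullet> l\<bar>"
      using z by blast
    have "norm (r *\<^sub>R z - x) = r * norm (z - x /\<^sub>R r)"
    proof -
      have "r *\<^sub>R z - x = r *\<^sub>R (z - x /\<^sub>R r)"
        using that by (simp add: scaleR_diff_right)
      then show ?thesis using that by simp
    qed
    then show ?thesis
      using z that by (intro exI[of _ "r *\<^sub>R z"]) (auto simp: abs_mult mult.commute)
  qed
  then show ?thesis using \<epsilon> by blast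
qed

text \<open>The integrand is dominated by a sum over \<open>n\<close> of
  \<open>(n+1) powr (- M)\<close> on the ball of radius \<open>r * (n+1)\<close>. The volumes grow
  like \<open>(n+1) ^ d\<close>, so \<open>M \<ge> d + 2\<close> leaves the convergent series of
  inverse squares.\<close>

lemma nn_integral_radial_decay:
  fixes M :: real
  assumes M: "M \<ge> real (DIM('a)) + 2"
  shows "\<exists>C>0. \<forall>(x :: 'a :: euclidean_space) r. 0 < r \<longrightarrow>
    (\<integral>\<^sup>+ u. ennreal ((1 + norm (u - x) / r) powr (- M)) \<partial>lborel) \<le> ennreal (C * r ^ DIM('a))"
proof -
  define d where "d = DIM('a)"
  define V where "V = unit_ball_vol (real d)"
  define Z :: real where "Z = (\<Sum>n. 1 / real (Suc n) ^ 2)"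
  have V: "V > 0" by (simp add: V_def)
  have summ: "summable (\<lambda>n. 1 / real (Suc n) ^ 2)"
    using inverse_power_summable[of 2, where 'a = real]
    by (subst summable_Suc_iff) (simp add: field_simps)
  have Z: "Z > 0" unfolding Z_def by (rule suminf_pos[OF summ]) simp
  have "(\<integral>\<^sup>+ u. ennreal ((1 + norm (u - x) / r) powr (- M)) \<partial>lborel) \<le> ennreal (V * Z * r ^ d)"
    if r: "r > 0" for x :: 'a and r
  proof -
    let ?f = "\<lambda>n u. ennreal (real (Suc n) powr (- M)) * indicator (ball x (r * Suc n)) u"
    have "(\<integral>\<^sup>+ u. ennreal ((1 + norm (u - x) / r) powr (- M)) \<partial>lborel)
        \<le> (\<integral>\<^sup>+ u. (\<Sum>n. ?f n u) \<partial>lborel)"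
    proof (rule nn_integral_mono)
      fix u :: 'a
      \<comment> \<open>With this integer part, the single term of index \<open>n\<close> already
        dominates the integrand at \<open>u\<close>; the strict upper bound puts \<open>u\<close>
        into the open ball.\<close>
      define n where "n = nat \<lfloor>norm (u - x) / r\<rfloor>"
      have n: "real n \<le> norm (u - x) / r" "norm (u - x) / r < real n + 1"
        using r unfolding n_def by auto
      have "norm (u - x) < r * Suc n" using n(2) r by (simp add: field_simps)
      then have u: "u \<in> ball x (r * Suc n)" by (simp add: dist_norm norm_minus_commute)
      have "(1 + norm (u - x) / r) powr (- M) \<le> real (Suc n) powr (- M)"
        using n M by (intro powr_mono2') auto
      then have "ennreal ((1 + norm (u - x) / r) powr (- M)) \<le> ?f n u"
        using u by (simp add: ennreal_leI)
      also have "\<dots> \<le> (\<Sum>m. ?f m u)"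
      proof -
        have "F n \<le> suminf F" for F :: "nat \<Rightarrow> ennreal"
          using sum_le_suminf[of F "{n}"] by simp
        from this[of "\<lambda>m. ?f m u"] show ?thesis .
      qed
      finally show "ennreal ((1 + norm (u - x) / r) powr (- M)) \<le> (\<Sum>m. ?f m u)" .
    qed
    also have "\<dots> = (\<Sum>n. ennreal (real (Suc n) powr (- M)) * emeasure lborel (ball x (r * Suc n)))"
    proof -
      have "(\<integral>\<^sup>+ u. ?f n u \<partial>lborel)
          = ennreal (real (Suc n) powr (- M)) * emeasure lborel (ball x (r * Suc n))" for n
        by (rule nn_integral_cmult_indicator) simp
      moreover have "?f n \<in> borel_measurable lborel" for n
        by (intro borel_measurable_times_ennreal borel_measurable_const borel_measurable_indicator) simp
      ultimately show ?thesis by (simp only: nn_integral_suminf)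
    qed
    also have "\<dots> \<le> (\<Sum>n. ennreal (V * r ^ d * (1 / real (Suc n) ^ 2)))"
    proof (rule suminf_le)
      fix n
      have "real (Suc n) powr (- M) * real (Suc n) ^ d = real (Suc n) powr (- M + real d)"
        by (simp only: powr_add powr_realpow of_nat_0_less_iff zero_less_Suc)
      also have "\<dots> \<le> real (Suc n) powr (- real 2)"
        using M by (intro powr_mono) (auto simp: d_def)
      also have "\<dots> = 1 / real (Suc n) ^ 2"
        by (subst powr_minus_divide, subst powr_realpow) auto
      finally have *: "real (Suc n) powr (- M) * real (Suc n) ^ d \<le> 1 / real (Suc n) ^ 2" .
      have "ennreal (real (Suc n) powr (- M)) * emeasure lborel (ball x (r * Suc n))
          = ennreal (V * r ^ d * (real (Suc n) powr (- M) * real (Suc n) ^ d))"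
        using r V by (simp add: emeasure_ball V_def d_def power_mult_distrib mult_ac flip: ennreal_mult del: of_nat_Suc)
      also have "\<dots> \<le> ennreal (V * r ^ d * (1 / real (Suc n) ^ 2))"
        using * r V by (intro ennreal_leI mult_left_mono) auto
      finally show "ennreal (real (Suc n) powr (- M)) * emeasure lborel (ball x (r * Suc n))
          \<le> ennreal (V * r ^ d * (1 / real (Suc n) ^ 2))" .
    qed auto
    also have "\<dots> = ennreal (\<Sum>n. V * r ^ d * (1 / real (Suc n) ^ 2))"
      using r V by (intro suminf_ennreal2 summable_mult summ) auto
    also have "(\<Sum>n. V * r ^ d * (1 / real (Suc n) ^ 2)) = V * Z * r ^ d"
      using suminf_mult[OF summ, of "V * r ^ d"] by (simp add: Z_def mult_ac)
    finally show ?thesis .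
  qed
  then show ?thesis
    using V Z by (intro exI[of _ "V * Z"]) (auto simp: d_def)
qed

section \<open>The Dunkl measure\<close>

text \<open>The weight at \<open>x\<close> regularized at scale \<open>r\<close>. The term
  \<open>2 * r\<close> bounds the change of an inner product with a root of norm
  \<open>sqrt 2\<close> under a displacement of length \<open>r\<close>. For \<open>r > 0\<close>
  all bases are positive, so exponent 0 gives the factor 1 without a case distinction.\<close>

definition root_product :: "(real ^ 'd) set \<Rightarrow> (real ^ 'd \<Rightarrow> real) \<Rightarrow> real ^ 'd \<Rightarrow> real \<Rightarrow> real" where
  "root_product R k x r = (\<Prod>l\<in>R. (\<bar>x \<bullet> l\<bar> + 2 * r) powr k l)"

lemma root_product_nonneg: "0 \<le> root_product R k x r"
  by (simp add: root_product_def prod_nonneg)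

text \<open>\<open>g\<close> permutes the roots, so the product can be reindexed by
  \<open>g\<close>; orthogonality and invariance of \<open>k\<close> then remove \<open>g\<close>.
  This makes the bounds around all points of an orbit agree.\<close>

lemma root_product_reflection_group:
  assumes "root_system R" "\<forall>g\<in>reflection_group R. \<forall>l\<in>R. k (g l) = k l"
    and g: "g \<in> reflection_group R"
  shows "root_product R k (g x) r = root_product R k x r"
proof -
  have o: "orthogonal_transformation g" and im: "g ` R = R"
    using reflection_group_orthogonal reflection_group_image assms by blast+
  have inj: "inj_on g R"
    using orthogonal_transformation_inj[OF o] inj_on_subset by blast
  have "root_product R k (g x) r = (\<Prod>l\<in>g ` R. (\<bar>g x \<bullet> l\<bar> + 2 * r) powr k l)"
    by (simp add: root_product_def im)
  also have "\<dots> = (\<Prod>l\<in>R. (\<bar>g x \<bullet> g l\<bar> + 2 * r) powr k (g l))"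
    by (simp add: prod.reindex[OF inj])
  also have "\<dots> = root_product R k x r"
    unfolding root_product_def using o assms(2) g
    by (intro prod.cong) (auto simp: orthogonal_transformation_def)
  finally show ?thesis .
qed

lemma dunkl_weight_nonneg: "0 \<le> dunkl_weight R k x"
  by (auto simp: dunkl_weight_def intro!: prod_nonneg)

lemma borel_measurable_dunkl_weight [measurable]: "dunkl_weight R k \<in> borel_measurable borel"
  unfolding dunkl_weight_def by measurable

text \<open>The integrand is nonnegative; a Bochner integral that does not exist has the default
  value 0, and \<open>inverse 0 = 0\<close>.\<close>

lemma dunkl_const_nonneg: "0 \<le> dunkl_const R k"
  by (simp add: dunkl_const_def dunkl_weight_nonneg)

lemma sets_dunkl_measure [measurable_cong, simp]: "sets (dunkl_measure R k) = sets borel"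
  by (simp add: dunkl_measure_def)

lemma nn_integral_dunkl_measure:
  assumes [measurable]: "f \<in> borel_measurable borel"
  shows "(\<integral>\<^sup>+ u. f u \<partial>dunkl_measure R k)
    = (\<integral>\<^sup>+ u. ennreal (dunkl_const R k * dunkl_weight R k u) * f u \<partial>lborel)"
  unfolding dunkl_measure_def by (intro nn_integral_density) measurable

section \<open>Comparison of the weight, the ball measure and the decay integrals with the root
  product\<close>

context
  fixes R :: "(real ^ 'd) set" and k :: "real ^ 'd \<Rightarrow> real"
  assumes R: "root_system R"
    and normalized: "\<forall>l\<in>R. norm l = sqrt 2"
    and k_nonneg: "\<forall>l\<in>R. 0 \<le> k l"
begin

lemma abs_inner_root_le:
  assumes "l \<in> R"
  shows "\<bar>u \<bullet> l\<bar> \<le> \<bar>x \<bullet> l\<bar> + 2 * norm (u - x)"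
proof -
  have "sqrt 2 \<le> 2" by (intro real_le_lsqrt) auto
  then have "\<bar>(u - x) \<bullet> l\<bar> \<le> norm (u - x) * 2"
    using Cauchy_Schwarz_ineq2[of "u - x" l] normalized assms
    by (metis mult_left_mono norm_ge_zero order_trans)
  then show ?thesis by (simp add: inner_diff_left)
qed

text \<open>Factor by factor, \<open>\<bar>x \<bullet> l\<bar> + 2 * norm (u - x)\<close> is at most
  \<open>\<bar>x \<bullet> l\<bar> + 2 * r\<close> times \<open>1 + norm (u - x) / r\<close>; the
  powers of the last factor collect into one exponent.\<close>

lemma dunkl_weight_le:
  assumes "0 < r"
  shows "dunkl_weight R k u \<le> root_product R k x r * (1 + norm (u - x) / r) powr (\<Sum>l\<in>R. k l)"
proof -
  let ?s = "1 + norm (u - x) / r"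
  have s: "?s > 0" using assms by (intro add_pos_nonneg) auto
  have "dunkl_weight R k u \<le> (\<Prod>l\<in>R. ((\<bar>x \<bullet> l\<bar> + 2 * r) * ?s) powr k l)"
    unfolding dunkl_weight_def
  proof (rule prod_mono, intro conjI)
    fix l assume l: "l \<in> R"
    let ?t = "(\<bar>x \<bullet> l\<bar> + 2 * r) * ?s"
    \<comment> \<open>Positivity matters when \<open>k l = 0\<close>: then
      \<open>?t powr 0 = 1\<close> equals the factor of the weight.\<close>
    have t: "?t > 0" using assms by (intro mult_pos_pos[OF _ s] add_nonneg_pos) auto
    have "\<bar>u \<bullet> l\<bar> \<le> \<bar>x \<bullet> l\<bar> + 2 * norm (u - x)" using abs_inner_root_le[OF l] .
    also have "\<dots> \<le> ?t" using assms by (simp add: algebra_simps)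
    finally have "\<bar>u \<bullet> l\<bar> powr k l \<le> ?t powr k l"
      using k_nonneg l by (intro powr_mono2) auto
    then show "(if k l = 0 then 1 else \<bar>u \<bullet> l\<bar> powr k l) \<le> ?t powr k l"
      using t by auto
  qed auto
  also have "\<dots> = root_product R k x r * (\<Prod>l\<in>R. ?s powr k l)"
    unfolding root_product_def prod.distrib[symmetric] using assms s
    by (intro prod.cong) (auto simp: powr_mult)
  also have "(\<Prod>l\<in>R. ?s powr k l) = ?s powr (\<Sum>l\<in>R. k l)"
    using s by (intro powr_sum[symmetric]) auto
  finally show ?thesis .
qed

lemma dunkl_weight_ge:
  assumes "0 < \<kappa>" and "0 < r" and far: "\<And>l. l \<in> R \<Longrightarrow> \<kappa> * (\<bar>x \<bullet> l\<bar> + 2 * r) \<le> \<bar>u \<bullet> l\<bar>"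
  shows "\<kappa> powr (\<Sum>l\<in>R. k l) * root_product R k x r \<le> dunkl_weight R k u"
proof -
  have "\<kappa> powr (\<Sum>l\<in>R. k l) * root_product R k x r = (\<Prod>l\<in>R. (\<kappa> * (\<bar>x \<bullet> l\<bar> + 2 * r)) powr k l)"
    using assms by (simp add: powr_sum root_product_def powr_mult flip: prod.distrib)
  also have "\<dots> \<le> dunkl_weight R k u"
    unfolding dunkl_weight_def
  proof (rule prod_mono, intro conjI)
    fix l assume l: "l \<in> R"
    have pos: "\<kappa> * (\<bar>x \<bullet> l\<bar> + 2 * r) > 0"
      using assms by (intro mult_pos_pos add_nonneg_pos) auto
    have "(\<kappa> * (\<bar>x \<bullet> l\<bar> + 2 * r)) powr k l \<le> \<bar>u \<bullet> l\<bar> powr k l"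
      using far[OF l] k_nonneg l pos by (intro powr_mono2) auto
    then show "(\<kappa> * (\<bar>x \<bullet> l\<bar> + 2 * r)) powr k l \<le> (if k l = 0 then 1 else \<bar>u \<bullet> l\<bar> powr k l)"
      using pos by auto
  qed auto
  finally show ?thesis .
qed

text \<open>Needed to pass from \<open>emeasure\<close> to \<open>measure\<close>, whose value on a
  set of infinite measure would be 0. On the ball the weight is bounded by
  \<open>dunkl_weight_le\<close>.\<close>

lemma emeasure_dunkl_ball_finite:
  assumes "0 < r"
  shows "emeasure (dunkl_measure R k) (ball x r) < \<infinity>"
proof -
  let ?K = "dunkl_const R k * (root_product R k x r * 2 powr (\<Sum>l\<in>R. k l))"
  have "emeasure (dunkl_measure R k) (ball x r)
      = (\<integral>\<^sup>+ u. ennreal (dunkl_const R k * dunkl_weight R k u) * indicator (ball x r) u \<partial>lborel)"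
    unfolding dunkl_measure_def by (rule emeasure_density) auto
  also have "\<dots> \<le> (\<integral>\<^sup>+ u. ennreal ?K * indicator (ball x r) u \<partial>lborel)"
  proof (rule nn_integral_mono)
    fix u
    have "dunkl_const R k * dunkl_weight R k u \<le> ?K" if "u \<in> ball x r"
    proof -
      have "norm (u - x) / r \<le> 1"
        using that assms by (simp add: dist_norm norm_minus_commute)
      then have "(1 + norm (u - x) / r) powr (\<Sum>l\<in>R. k l) \<le> 2 powr (\<Sum>l\<in>R. k l)"
        using assms k_nonneg by (intro powr_mono2) (auto simp: sum_nonneg)
      then have "dunkl_weight R k u \<le> root_product R k x r * 2 powr (\<Sum>l\<in>R. k l)"
        using dunkl_weight_le[OF assms, of u x] root_product_nonneg[of R k x r]
        by (meson mult_left_mono order_trans)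
      then show ?thesis using dunkl_const_nonneg by (intro mult_left_mono)
    qed
    then show "ennreal (dunkl_const R k * dunkl_weight R k u) * indicator (ball x r) u
        \<le> ennreal ?K * indicator (ball x r) u"
      by (auto simp: indicator_def intro: ennreal_leI)
  qed
  also have "\<dots> = ennreal ?K * emeasure lborel (ball x r)"
    by (simp add: nn_integral_cmult_indicator)
  also have "\<dots> < \<infinity>"
    using assms by (simp add: emeasure_ball ennreal_mult_less_top)
  finally show ?thesis .
qed

text \<open>The ball contains one of radius \<open>\<delta> * r\<close> around a point far from all
  hyperplanes, where the weight is at least a constant times the root product; only the smaller ball
  is integrated over.\<close>

lemma measure_dunkl_ball_ge:
  "\<exists>c>0. \<forall>x r. 0 < r \<longrightarrow>
    dunkl_const R k * (c * r ^ CARD('d) * root_product R k x r) \<le> measure (dunkl_measure R k) (ball x r)"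
proof -
  let ?\<gamma> = "\<Sum>l\<in>R. k l"
  obtain \<epsilon> where \<epsilon>: "\<epsilon> > 0" and
    far: "\<And>x r. 0 < r \<Longrightarrow> \<exists>z. norm (z - x) \<le> 1 / 2 * r \<and> (\<forall>l\<in>R. \<epsilon> * r \<le> \<bar>z \<bullet> l\<bar>)"
    using exists_far_from_hyperplanes_scaled[OF finite_roots[OF R] zero_notin_roots[OF R], of "1 / 2"]
    by auto
  \<comment> \<open>The bound \<open>1 / 2\<close> keeps the small ball inside
    \<open>ball x r\<close>, its centre being within \<open>r / 2\<close> of \<open>x\<close>. The
    bound \<open>\<epsilon> / 4\<close> limits the change of inner products to
    \<open>\<epsilon> * r / 2\<close>, half of what \<open>z\<close> guarantees.\<close>
  define \<delta> where "\<delta> = min (\<epsilon> / 4) (1 / 2)"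
  have \<delta>: "\<delta> > 0" "\<delta> \<le> \<epsilon> / 4" "\<delta> \<le> 1 / 2" using \<epsilon> by (auto simp: \<delta>_def)
  \<comment> \<open>On the small ball
    \<open>\<epsilon> * r / 2 \<le> \<bar>u \<bullet> l\<bar>\<close>, that is, \<open>4 * r\<close>
    is at most \<open>8 / \<epsilon>\<close> times \<open>\<bar>u \<bullet> l\<bar>\<close>; and
    \<open>\<bar>x \<bullet> l\<bar> + 2 * r\<close> is at most
    \<open>\<bar>u \<bullet> l\<bar> + 4 * r\<close>.\<close>
  define \<kappa> where "\<kappa> = 1 / (1 + 8 / \<epsilon>)"
  have \<kappa>: "\<kappa> > 0" using \<epsilon> by (simp add: \<kappa>_def add_pos_pos)
  define V where "V = unit_ball_vol (real CARD('d)) * \<delta> ^ CARD('d)"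
  have V: "V > 0" using \<delta> by (simp add: V_def)
  have "dunkl_const R k * (\<kappa> powr ?\<gamma> * V * r ^ CARD('d) * root_product R k x r)
      \<le> measure (dunkl_measure R k) (ball x r)" if r: "r > 0" for x r
  proof -
    obtain z where z: "norm (z - x) \<le> r / 2" "\<And>l. l \<in> R \<Longrightarrow> \<epsilon> * r \<le> \<bar>z \<bullet> l\<bar>"
      using far[OF r, of x] by auto
    have sub: "ball z (\<delta> * r) \<subseteq> ball x r"
    proof
      fix u assume "u \<in> ball z (\<delta> * r)"
      moreover have "\<delta> * r \<le> 1 / 2 * r" using \<delta> r by (intro mult_right_mono) auto
      ultimately show "u \<in> ball x r"
        using z(1) dist_triangle[of x u z] by (simp add: dist_norm norm_minus_commute)
    qed
    let ?K = "dunkl_const R k * (\<kappa> powr ?\<gamma> * root_product R k x r)"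
    have "ennreal (dunkl_const R k * (\<kappa> powr ?\<gamma> * V * r ^ CARD('d) * root_product R k x r))
        = ennreal ?K * emeasure lborel (ball z (\<delta> * r))"
      using r \<delta> dunkl_const_nonneg[of R k] root_product_nonneg[of R k x r]
      by (simp add: emeasure_ball V_def power_mult_distrib mult_ac flip: ennreal_mult)
    also have "\<dots> = (\<integral>\<^sup>+ u. ennreal ?K * indicator (ball z (\<delta> * r)) u \<partial>lborel)"
      by (simp add: nn_integral_cmult_indicator)
    also have "\<dots> \<le> (\<integral>\<^sup>+ u. ennreal (dunkl_const R k * dunkl_weight R k u) * indicator (ball x r) u \<partial>lborel)"
    proof (rule nn_integral_mono)
      fix u
      show "ennreal ?K * indicator (ball z (\<delta> * r)) u
        \<le> ennreal (dunkl_const R k * dunkl_weight R k u) * indicator (ball x r) u"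
      proof (cases "u \<in> ball z (\<delta> * r)")
        case True
        have "\<kappa> * (\<bar>x \<bullet> l\<bar> + 2 * r) \<le> \<bar>u \<bullet> l\<bar>" if l: "l \<in> R" for l
        proof -
          have "norm (z - u) \<le> \<epsilon> / 4 * r"
            using True \<delta> r mult_right_mono[of \<delta> "\<epsilon> / 4" r]
            unfolding mem_ball dist_norm by linarith
          then have "\<epsilon> * r \<le> \<bar>u \<bullet> l\<bar> + \<epsilon> / 2 * r"
            using abs_inner_root_le[OF l, of z u] z(2)[OF l] by simp
          then have "4 * r \<le> \<bar>u \<bullet> l\<bar> * (8 / \<epsilon>)"
            using \<epsilon> by (simp add: field_simps)
          moreover have "\<bar>x \<bullet> l\<bar> \<le> \<bar>u \<bullet> l\<bar> + 2 * r"
          proof -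
            have "norm (x - u) < r" using True sub by (auto simp: dist_norm)
            then show ?thesis using abs_inner_root_le[OF l, of x u] by linarith
          qed
          ultimately have "\<bar>x \<bullet> l\<bar> + 2 * r \<le> \<bar>u \<bullet> l\<bar> * (1 + 8 / \<epsilon>)"
            by (simp add: algebra_simps)
          moreover have "1 + 8 / \<epsilon> > 0" using \<epsilon> by (simp add: add_pos_pos)
          ultimately show ?thesis by (simp add: \<kappa>_def pos_divide_le_eq)
        qed
        then have "?K \<le> dunkl_const R k * dunkl_weight R k u"
          using dunkl_weight_ge[OF \<kappa> r] dunkl_const_nonneg by (intro mult_left_mono) auto
        then show ?thesis using True sub by (auto simp: indicator_def intro: ennreal_leI)
      qed simp
    qed
    also have "\<dots> = emeasure (dunkl_measure R k) (ball x r)"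
      unfolding dunkl_measure_def by (rule emeasure_density[symmetric]) auto
    also have "\<dots> = ennreal (measure (dunkl_measure R k) (ball x r))"
      using emeasure_dunkl_ball_finite[OF r, of x] by (intro emeasure_eq_ennreal_measure) auto
    finally show ?thesis by (simp add: ennreal_le_iff)
  qed
  then show ?thesis using V \<kappa> by (intro exI[of _ "\<kappa> powr ?\<gamma> * V"]) auto
qed

text \<open>The growth of the weight costs the sum of the \<open>k l\<close> in the exponent; what
  remains is at least \<open>CARD('d) + 2\<close>, enough for the Lebesgue estimate.\<close>

lemma nn_integral_dunkl_radial_decay:
  assumes L: "L \<ge> hom_dim R k + 2"
  shows "\<exists>C>0. \<forall>x r. 0 < r \<longrightarrow>
    (\<integral>\<^sup>+ u. ennreal ((1 + norm (u - x) / r) powr (- L)) \<partial>dunkl_measure R k)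
      \<le> ennreal (dunkl_const R k * (C * r ^ CARD('d) * root_product R k x r))"
proof -
  let ?\<gamma> = "\<Sum>l\<in>R. k l"
  obtain C where C: "C > 0" and bound: "\<And>(x :: real ^ 'd) r. 0 < r \<Longrightarrow>
      (\<integral>\<^sup>+ u. ennreal ((1 + norm (u - x) / r) powr (- (L - ?\<gamma>))) \<partial>lborel) \<le> ennreal (C * r ^ CARD('d))"
    using nn_integral_radial_decay[where 'a = "real ^ 'd", of "L - ?\<gamma>"] L
    by (auto simp: hom_dim_def)
  have "(\<integral>\<^sup>+ u. ennreal ((1 + norm (u - x) / r) powr (- L)) \<partial>dunkl_measure R k)
      \<le> ennreal (dunkl_const R k * (C * r ^ CARD('d) * root_product R k x r))" if r: "r > 0" for x r
  proof -
    let ?K = "dunkl_const R k * root_product R k x r"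
    have K: "?K \<ge> 0" by (simp add: dunkl_const_nonneg root_product_nonneg)
    have "(\<integral>\<^sup>+ u. ennreal ((1 + norm (u - x) / r) powr (- L)) \<partial>dunkl_measure R k)
        = (\<integral>\<^sup>+ u. ennreal (dunkl_const R k * dunkl_weight R k u)
            * ennreal ((1 + norm (u - x) / r) powr (- L)) \<partial>lborel)"
      by (rule nn_integral_dunkl_measure) measurable
    also have "\<dots> \<le> (\<integral>\<^sup>+ u. ennreal ?K * ennreal ((1 + norm (u - x) / r) powr (- (L - ?\<gamma>))) \<partial>lborel)"
    proof (rule nn_integral_mono)
      fix u
      let ?s = "1 + norm (u - x) / r"
      have "dunkl_const R k * dunkl_weight R k u * ?s powr (- L)
          \<le> dunkl_const R k * (root_product R k x r * ?s powr ?\<gamma>) * ?s powr (- L)"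
        using dunkl_weight_le[OF r] dunkl_const_nonneg by (intro mult_right_mono mult_left_mono) auto
      also have "\<dots> = ?K * ?s powr (- (L - ?\<gamma>))"
        using powr_add[of ?s ?\<gamma> "- L"] by simp
      finally show "ennreal (dunkl_const R k * dunkl_weight R k u) * ennreal (?s powr (- L))
          \<le> ennreal ?K * ennreal (?s powr (- (L - ?\<gamma>)))"
        using K by (simp add: dunkl_const_nonneg dunkl_weight_nonneg ennreal_leI flip: ennreal_mult)
    qed
    also have "\<dots> = ennreal ?K * (\<integral>\<^sup>+ u. ennreal ((1 + norm (u - x) / r) powr (- (L - ?\<gamma>))) \<partial>lborel)"
      by (rule nn_integral_cmult) measurable
    also have "\<dots> \<le> ennreal ?K * ennreal (C * r ^ CARD('d))"
      using bound[OF r] by (intro mult_left_mono) auto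
    also have "\<dots> = ennreal (dunkl_const R k * (C * r ^ CARD('d) * root_product R k x r))"
      using K C r by (simp add: mult_ac flip: ennreal_mult)
    finally show ?thesis .
  qed
  then show ?thesis using C by blast
qed

text \<open>The integrand at \<open>u\<close> is one of the radial profiles centred at the orbit
  points \<open>g x\<close>, hence at most their finite sum. Each profile has an integral bounded by
  the same root product.\<close>

lemma nn_integral_orbit_dist_decay:
  assumes k_inv: "\<forall>g\<in>reflection_group R. \<forall>l\<in>R. k (g l) = k l"
    and L: "L \<ge> hom_dim R k + 2"
  shows "\<exists>C>0. \<forall>x r. 0 < r \<longrightarrow>
    (\<integral>\<^sup>+ u. ennreal ((1 + orbit_dist R x u / r) powr (- L)) \<partial>dunkl_measure R k)
      \<le> ennreal (C * measure (dunkl_measure R k) (ball x r))"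
proof -
  let ?G = "reflection_group R"
  have "0 \<le> hom_dim R k" using k_nonneg by (simp add: hom_dim_def sum_nonneg)
  then have L0: "L \<ge> 0" using L by simp
  obtain C where C: "C > 0" and upper: "\<And>x r. 0 < r \<Longrightarrow>
      (\<integral>\<^sup>+ u. ennreal ((1 + norm (u - x) / r) powr (- L)) \<partial>dunkl_measure R k)
      \<le> ennreal (dunkl_const R k * (C * r ^ CARD('d) * root_product R k x r))"
    using nn_integral_dunkl_radial_decay[OF L] by blast
  obtain c where c: "c > 0" and lower: "\<And>x r. 0 < r \<Longrightarrow>
      dunkl_const R k * (c * r ^ CARD('d) * root_product R k x r) \<le> measure (dunkl_measure R k) (ball x r)"
    using measure_dunkl_ball_ge by blast
  \<comment> \<open>One summand per group element, each contributing the ratio of the upper to the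
    lower constant.\<close>
  let ?C = "real (card ?G) * (C / c)"
  have "card ?G > 0"
    using finite_reflection_group[OF R] reflection_group_nonempty[OF R] by (simp add: card_gt_0_iff)
  then have "?C > 0" using C c by simp
  moreover have "(\<integral>\<^sup>+ u. ennreal ((1 + orbit_dist R x u / r) powr (- L)) \<partial>dunkl_measure R k)
      \<le> ennreal (?C * measure (dunkl_measure R k) (ball x r))" if r: "r > 0" for x r
  proof -
    have "(\<integral>\<^sup>+ u. ennreal ((1 + orbit_dist R x u / r) powr (- L)) \<partial>dunkl_measure R k)
        \<le> (\<integral>\<^sup>+ u. (\<Sum>g\<in>?G. ennreal ((1 + norm (u - g x) / r) powr (- L))) \<partial>dunkl_measure R k)"
    proof (rule nn_integral_mono)
      fix u
      obtain g where g: "g \<in> ?G" "orbit_dist R x u = norm (g x - u)"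
        by (rule orbit_dist_attained[OF R])
      have "ennreal ((1 + orbit_dist R x u / r) powr (- L))
          = ennreal ((1 + norm (u - g x) / r) powr (- L))"
        using g by (simp add: norm_minus_commute)
      also have "\<dots> \<le> (\<Sum>g\<in>?G. ennreal ((1 + norm (u - g x) / r) powr (- L)))"
        using g finite_reflection_group[OF R]
        by (intro member_le_sum[where f = "\<lambda>g. ennreal ((1 + norm (u - g x) / r) powr (- L))"]) auto
      finally show "ennreal ((1 + orbit_dist R x u / r) powr (- L))
          \<le> (\<Sum>g\<in>?G. ennreal ((1 + norm (u - g x) / r) powr (- L)))" .
    qed
    also have "\<dots> = (\<Sum>g\<in>?G. \<integral>\<^sup>+ u. ennreal ((1 + norm (u - g x) / r) powr (- L)) \<partial>dunkl_measure R k)"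
      by (intro nn_integral_sum) measurable
    also have "\<dots> \<le> (\<Sum>g\<in>?G. ennreal (C / c * measure (dunkl_measure R k) (ball x r)))"
    proof (rule sum_mono)
      fix g assume g: "g \<in> ?G"
      have "(\<integral>\<^sup>+ u. ennreal ((1 + norm (u - g x) / r) powr (- L)) \<partial>dunkl_measure R k)
          \<le> ennreal (dunkl_const R k * (C * r ^ CARD('d) * root_product R k x r))"
        using upper[OF r, of "g x"] root_product_reflection_group[OF R k_inv g] by simp
      also have "\<dots> = ennreal (C / c * (dunkl_const R k * (c * r ^ CARD('d) * root_product R k x r)))"
        using c by (simp add: field_simps)
      also have "\<dots> \<le> ennreal (C / c * measure (dunkl_measure R k) (ball x r))"
        using lower[OF r] C c by (intro ennreal_leI mult_left_mono) auto
      finally show "(\<integral>\<^sup>+ u. ennreal ((1 + norm (u - g x) / r) powr (- L)) \<partial>dunkl_measure R k)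
          \<le> ennreal (C / c * measure (dunkl_measure R k) (ball x r))" .
    qed
    also have "\<dots> = ennreal (?C * measure (dunkl_measure R k) (ball x r))"
      using C c by (simp add: ennreal_of_nat_eq_real_of_nat mult_ac flip: ennreal_mult)
    finally show ?thesis .
  qed
  ultimately show ?thesis by blast
qed

end

section \<open>The pointwise bound and the conclusion\<close>

lemma one_add_le_mult:
  fixes A B D :: real
  assumes "0 \<le> A" "0 \<le> B" "D \<le> A + B"
  shows "1 + D \<le> (1 + A) * (1 + B)"
  using mult_nonneg_nonneg[OF assms(1,2)] assms(3) by (simp add: algebra_simps)

theorem proposition3p2:
  fixes R :: "(real ^ 'd) set" and k :: "real ^ 'd \<Rightarrow> real" and L :: real
  assumes "root_system R"
    and "\<forall>l\<in>R. norm l = sqrt 2"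
    and "\<forall>l\<in>R. 0 \<le> k l"
    and "\<forall>g\<in>reflection_group R. \<forall>l\<in>R. k (g l) = k l"
    and "L > 3 * hom_dim R k"
  shows "\<exists>C>0. \<forall>x y1 y2 :: real ^ 'd. \<forall>j :: int.
    (\<integral>\<^sup>+ u. ennreal (1 / ((1 + 2 powi j * orbit_dist R x u) *
                        (1 + 2 powi j * orbit_dist R y1 u) *
                        (1 + 2 powi j * orbit_dist R y2 u)) powr (3 * L)) \<partial>dunkl_measure R k)
    \<le> ennreal (C * measure (dunkl_measure R k) (ball x (2 powi (- j))) /
               ((1 + 2 powi j * orbit_dist R x y1) *
                (1 + 2 powi j * orbit_dist R x y2)) powr L)"
proof -
  note R = assms(1)
  \<comment> \<open>The homogeneous dimension is at least 1, so three times it is at least itself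
    plus 2.\<close>
  have "real CARD('d) \<ge> 1"
    by (simp add: Suc_le_eq)
  then have hd: "hom_dim R k \<ge> 1"
    using assms(3) by (simp add: hom_dim_def sum_nonneg add_increasing2)
  then have L: "L \<ge> hom_dim R k + 2" "L \<ge> 0" using assms(5) by auto
  obtain C where C: "C > 0" and decay: "\<And>x r. 0 < r \<Longrightarrow>
      (\<integral>\<^sup>+ u. ennreal ((1 + orbit_dist R x u / r) powr (- L)) \<partial>dunkl_measure R k)
      \<le> ennreal (C * measure (dunkl_measure R k) (ball x r))"
    using nn_integral_orbit_dist_decay[OF assms(1-4) L(1)] by blast
  have "(\<integral>\<^sup>+ u. ennreal (1 / ((1 + 2 powi j * orbit_dist R x u) *
                        (1 + 2 powi j * orbit_dist R y1 u) *
                        (1 + 2 powi j * orbit_dist R y2 u)) powr (3 * L)) \<partial>dunkl_measure R k)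
    \<le> ennreal (C * measure (dunkl_measure R k) (ball x (2 powi (- j))) /
               ((1 + 2 powi j * orbit_dist R x y1) *
                (1 + 2 powi j * orbit_dist R x y2)) powr L)" (is "?I \<le> _")
    for x y1 y2 :: "real ^ 'd" and j :: int
  proof -
    define s :: real where "s = 2 powi j"
    have s: "s > 0" by (simp add: s_def)
    have r: "2 powi (- j) = 1 / s" by (simp add: s_def power_int_minus_divide)
    define E where "E = ((1 + s * orbit_dist R x y1) * (1 + s * orbit_dist R x y2)) powr L"
    have pos: "1 \<le> 1 + s * orbit_dist R y u" for y u
      using s orbit_dist_nonneg[OF R] by simp
    have E: "E > 0" using pos[of x y1] pos[of x y2] by (auto simp: E_def)
    \<comment> \<open>The exponent \<open>3 * L\<close> is spent on three powers of the factor
      belonging to \<open>x\<close>: two absorb \<open>E\<close> through the triangle inequality via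
      \<open>u\<close>, the third is the decay left for the integral. The other two factors are at
      least 1, so raising their exponent only helps.\<close>
    have ptw: "1 / ((1 + s * orbit_dist R x u) * (1 + s * orbit_dist R y1 u) *
        (1 + s * orbit_dist R y2 u)) powr (3 * L) \<le> 1 / E * (1 + s * orbit_dist R x u) powr (- L)" for u
    proof -
      define a b c where "a = 1 + s * orbit_dist R x u"
        and "b = 1 + s * orbit_dist R y1 u" and "c = 1 + s * orbit_dist R y2 u"
      have abc: "1 \<le> a" "1 \<le> b" "1 \<le> c" using pos by (auto simp: a_def b_def c_def)
      have tri: "1 + s * orbit_dist R x y \<le> a * (1 + s * orbit_dist R y u)" for y
        unfolding a_def using s orbit_dist_nonneg[OF R] orbit_dist_triangle[OF R, of x y u]
        by (intro one_add_le_mult) (auto simp flip: distrib_left)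
      have "E * a powr L \<le> ((a * b) * (a * c)) powr L * a powr L"
        unfolding E_def using pos[of x y1] pos[of x y2] tri[of y1] tri[of y2] L abc
        by (intro mult_right_mono powr_mono2 mult_mono) (auto simp: b_def c_def)
      also have "\<dots> = (a ^ 3 * (b * c)) powr L"
        using abc by (subst powr_mult[symmetric]) (simp_all add: power3_eq_cube mult_ac)
      also have "\<dots> \<le> ((a * b * c) ^ 3) powr L"
      proof -
        have "1 \<le> b * c" using mult_mono[of 1 b 1 c] abc by simp
        then have "b * c \<le> (b * c) ^ 3" using power_increasing[of 1 3 "b * c"] by simp
        then have "a ^ 3 * (b * c) \<le> (a * b * c) ^ 3"
          using abc by (simp add: power_mult_distrib mult.assoc)
        then show ?thesis using abc L by (intro powr_mono2) auto
      qed
      also have "\<dots> = (a * b * c) powr (3 * L)"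
        using abc powr_powr[of "a * b * c" 3 L] by (simp add: powr_numeral)
      finally have "E * a powr L \<le> (a * b * c) powr (3 * L)" .
      moreover have "0 < E * a powr L" using E abc by simp
      ultimately have "1 / (a * b * c) powr (3 * L) \<le> 1 / (E * a powr L)"
        using abc by (intro divide_left_mono) auto
      then show ?thesis by (simp add: powr_minus_divide a_def b_def c_def)
    qed
    \<comment> \<open>The orbit distance is a finite minimum of continuous functions of
      \<open>u\<close>.\<close>
    have meas: "(\<lambda>u. ennreal ((1 + s * orbit_dist R x u) powr (- L))) \<in> borel_measurable (dunkl_measure R k)"
    proof -
      have "(\<lambda>u. orbit_dist R x u) \<in> borel_measurable borel"
        unfolding orbit_dist_def using finite_reflection_group[OF R]
        by (rule borel_measurable_Min) measurable
      then show ?thesis by measurable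
    qed
    have "?I \<le> (\<integral>\<^sup>+ u. ennreal (1 / E) * ennreal ((1 + s * orbit_dist R x u) powr (- L)) \<partial>dunkl_measure R k)"
      using E ptw unfolding s_def[symmetric]
      by (intro nn_integral_mono) (simp add: ennreal_leI flip: ennreal_mult)
    also have "\<dots> = ennreal (1 / E) * (\<integral>\<^sup>+ u. ennreal ((1 + s * orbit_dist R x u) powr (- L)) \<partial>dunkl_measure R k)"
      by (rule nn_integral_cmult[OF meas])
    also have "\<dots> \<le> ennreal (1 / E) * ennreal (C * measure (dunkl_measure R k) (ball x (1 / s)))"
      using decay[of "1 / s" x] s by (intro mult_left_mono) (auto simp: mult.commute)
    also have "\<dots> = ennreal (C * measure (dunkl_measure R k) (ball x (1 / s)) / E)"
      using E C by (simp flip: ennreal_mult)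
    finally show ?thesis by (simp add: r E_def s_def)
  qed
  then show ?thesis using C by blast
qed

end
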